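(* Every connected Lie group is natural.
   Context: Lie groups are real, finite-dimensional and second countable. A group $(G,* )$ is called natural if there exists a metric $d$ on the underlying set $G$ such that (i) every right translation $R_g: x \mapsto x*g$, $g \in G$, is an isometry of $(G,d)$, and (ii) whenever $(G,\circ)$ is any group structure on the same set $G$ all of whose right translations are isometries of $(G,d)$, then $(G,\circ)$ is isomorphic to $(G,* )$ as an abstract group. The metric $d$ is not required to induce the Lie group topology, and naturality is a property of the underlying abstract group. *)

theory Defs
  imports "HOL-Analysis.Analysis" "HOL-Algebra.Group"
begin

section \<open>Smooth maps on open subsets of a finite-dimensional vector space\<close>

text \<open>
  Smooth manifolds are modelled on a linear subspace \<open>V\<close> of a type of class \<open>euclidean_space\<close>.
  Types of that class have dimension at least 1, so taking only \<open>V = UNIV\<close> would leave out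
  0-dimensional manifolds; as \<open>V\<close> varies, every dimension occurs.

  Below, \<open>S\<close> is meant to be relatively open in \<open>V\<close>. Then a derivative \<open>D x\<close> within \<open>S\<close> is uniquely
  determined on \<open>V\<close>, and only its values on \<open>V\<close> are used in the recursion.
\<close>

primrec Ck_on ::
  "nat \<Rightarrow> 'e::real_normed_vector set \<Rightarrow> 'e set \<Rightarrow> ('e \<Rightarrow> 'f::real_normed_vector) \<Rightarrow> bool" where
  "Ck_on 0 V S f \<longleftrightarrow> continuous_on S f"
| "Ck_on (Suc k) V S f \<longleftrightarrow>
     (\<exists>D. (\<forall>x\<in>S. (f has_derivative D x) (at x within S)) \<and> (\<forall>v\<in>V. Ck_on k V S (\<lambda>x. D x v)))"

definition smooth_on ::
  "'e::real_normed_vector set \<Rightarrow> 'e set \<Rightarrow> ('e \<Rightarrow> 'f::real_normed_vector) \<Rightarrow> bool" where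
  "smooth_on V S f \<longleftrightarrow> (\<forall>k. Ck_on k V S f)"


section \<open>Smooth manifolds\<close>

text \<open>A chart is a pair (domain, coordinate map); values of the map outside the domain are irrelevant.\<close>

type_synonym ('a, 'e) chart = "'a set \<times> ('a \<Rightarrow> 'e)"

definition is_chart :: "'a topology \<Rightarrow> 'e::euclidean_space set \<Rightarrow> ('a, 'e) chart \<Rightarrow> bool" where
  "is_chart T V c \<longleftrightarrow> (case c of (U, \<phi>) \<Rightarrow>
     openin T U \<and> openin (top_of_set V) (\<phi> ` U) \<and>
     homeomorphic_map (subtopology T U) (top_of_set (\<phi> ` U)) \<phi>)"

definition smooth_atlas :: "'a topology \<Rightarrow> 'e::euclidean_space set \<Rightarrow> ('a, 'e) chart set \<Rightarrow> bool" where
  "smooth_atlas T V A \<longleftrightarrow>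
     (\<forall>c\<in>A. is_chart T V c) \<and>
     topspace T \<subseteq> \<Union> (fst ` A) \<and>
     (\<forall>(U, \<phi>)\<in>A. \<forall>(W, \<psi>)\<in>A. smooth_on V (\<phi> ` (U \<inter> W)) (\<psi> \<circ> inv_into U \<phi>))"

definition smooth_manifold :: "'a topology \<Rightarrow> 'e::euclidean_space set \<Rightarrow> ('a, 'e) chart set \<Rightarrow> bool" where
  "smooth_manifold T V A \<longleftrightarrow>
     subspace V \<and> Hausdorff_space T \<and> second_countable T \<and> smooth_atlas T V A"

definition smooth_map ::
  "'a topology \<Rightarrow> 'e::euclidean_space set \<Rightarrow> ('a, 'e) chart set \<Rightarrow>
   'b topology \<Rightarrow> ('b, 'f::euclidean_space) chart set \<Rightarrow> ('a \<Rightarrow> 'b) \<Rightarrow> bool" where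
  "smooth_map T V A T' A' f \<longleftrightarrow>
     continuous_map T T' f \<and>
     (\<forall>(U, \<phi>)\<in>A. \<forall>(W, \<psi>)\<in>A'.
        smooth_on V (\<phi> ` {x \<in> U. f x \<in> W}) (\<psi> \<circ> f \<circ> inv_into U \<phi>))"

definition prod_atlas ::
  "('a, 'e) chart set \<Rightarrow> ('b, 'f) chart set \<Rightarrow> ('a \<times> 'b, 'e \<times> 'f) chart set" where
  "prod_atlas A B = (\<lambda>((U, \<phi>), (W, \<psi>)). (U \<times> W, map_prod \<phi> \<psi>)) ` (A \<times> B)"


section \<open>Lie groups\<close>

definition lie_group ::
  "('a, 'r) monoid_scheme \<Rightarrow> 'a topology \<Rightarrow> 'e::euclidean_space set \<Rightarrow> ('a, 'e) chart set \<Rightarrow> bool" where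
  "lie_group G T V A \<longleftrightarrow>
     group G \<and> topspace T = carrier G \<and> smooth_manifold T V A \<and>
     smooth_map (prod_topology T T) (V \<times> V) (prod_atlas A A) T A (\<lambda>(x, y). x \<otimes>\<^bsub>G\<^esub> y) \<and>
     smooth_map T V A T A (\<lambda>x. inv\<^bsub>G\<^esub> x)"


section \<open>Natural groups\<close>

definition isometry_on :: "'a set \<Rightarrow> ('a \<Rightarrow> 'a \<Rightarrow> real) \<Rightarrow> ('a \<Rightarrow> 'a) \<Rightarrow> bool" where
  "isometry_on M d f \<longleftrightarrow> bij_betw f M M \<and> (\<forall>x\<in>M. \<forall>y\<in>M. d (f x) (f y) = d x y)"

definition right_translations_isometric ::
  "('a, 'r) monoid_scheme \<Rightarrow> ('a \<Rightarrow> 'a \<Rightarrow> real) \<Rightarrow> bool" where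
  "right_translations_isometric G d \<longleftrightarrow>
     (\<forall>g\<in>carrier G. isometry_on (carrier G) d (\<lambda>x. x \<otimes>\<^bsub>G\<^esub> g))"

definition natural_group :: "('a, 'r) monoid_scheme \<Rightarrow> bool" where
  "natural_group G \<longleftrightarrow>
     group G \<and>
     (\<exists>d. Metric_space (carrier G) d \<and>
        right_translations_isometric G d \<and>
        (\<forall>H :: 'a monoid.
           group H \<and> carrier H = carrier G \<and> right_translations_isometric H d \<longrightarrow> H \<cong> G))"

end

theory Submission
  imports Defs
begin

text \<open>
  Right-invariant metrics on \<open>G\<close> correspond to length functions \<open>l\<close> via
  \<open>d x y = l (x y\<inverse>)\<close>. A function with \<open>l 1 = 0\<close>, \<open>l (x\<inverse>) = l x\<close> and all other values
  in \<open>[4, 8]\<close> satisfies the triangle inequality for free, because \<open>8 \<le> 4 + 4\<close>. A second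
  countable Hausdorff space has at most as many points as the real line, so \<open>l\<close> can be chosen to
  separate any two elements that are not inverse to each other. This is the metric that is used.
  
  An isometry \<open>f\<close> with \<open>f 1 = 1\<close> then satisfies \<open>f x (f y)\<inverse> = (x y\<inverse>)\<^bsup>\<plusminus>1\<^esup>\<close> for all \<open>x, y\<close>; in
  particular each \<open>f x\<close> is \<open>x\<close> or \<open>x\<inverse>\<close>. Comparing fixed and inverted elements shows that, unless
  \<open>f\<close> is the identity, all squares in \<open>G\<close> commute with each other
  (\<open>squares_commute_if_moving\<close>). If \<open>G\<close> has no proper subgroup containing all squares, this makes
  \<open>G\<close> abelian, and \<open>f\<close> is then inversion. So every isometry is a right translation or, for abelian
  \<open>G\<close>, a map \<open>x \<mapsto> x\<inverse> g\<close> (\<open>isometry_cases\<close>).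
  
  Let \<open>H\<close> be another group structure with isometric right translations. A map \<open>x \<mapsto> x\<inverse> g\<close> fixes
  every square root of \<open>g\<close>, and square roots exist since \<open>G\<close> is abelian and generated by squares,
  whereas a right translation of \<open>H\<close> with a fixed point is the identity. Hence the right translations
  of \<open>H\<close> are among those of \<open>G\<close>; both sets act simply transitively, so \<open>H\<close> and \<open>G\<close> are
  isomorphic (\<open>natural_group_if_generated_by_squares\<close>).
  
  A connected Lie group is generated by squares: in a chart around \<open>1\<close> the derivative of \<open>x \<mapsto> x\<^sup>2\<close>
  at \<open>1\<close> is twice the identity, so the squares contain a neighbourhood of \<open>1\<close>, and a subgroup
  containing such a neighbourhood is open and closed.
\<close>

section \<open>Groups generated by squares\<close>

text \<open>
  Phrased without generated subgroups: in the proofs the subgroup \<open>K\<close> is a centralizer, the set of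
  squares of an abelian group, or an arbitrary subgroup shown to be open and closed. The squares
  generate a normal subgroup whose quotient is a vector space over the field with two elements, so the
  condition says that \<open>G\<close> has no subgroup of index 2.
\<close>

definition generated_by_squares :: "('a, 'r) monoid_scheme \<Rightarrow> bool" where
  "generated_by_squares G \<longleftrightarrow>
     (\<forall>K. subgroup K G \<longrightarrow> (\<forall>x\<in>carrier G. x \<otimes>\<^bsub>G\<^esub> x \<in> K) \<longrightarrow> K = carrier G)"

lemma (in group) centralizer_subgroup:
  assumes "S \<subseteq> carrier G"
  shows "subgroup {z \<in> carrier G. \<forall>s\<in>S. z \<otimes> s = s \<otimes> z} G"
proof (rule subgroupI)
  fix z assume z: "z \<in> {z \<in> carrier G. \<forall>s\<in>S. z \<otimes> s = s \<otimes> z}"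
  have "inv z \<otimes> s = s \<otimes> inv z" if "s \<in> S" for s
  proof -
    have s: "s \<in> carrier G" using assms that by auto
    have "inv z \<otimes> s = inv z \<otimes> (s \<otimes> z) \<otimes> inv z"
      using z s by (simp add: m_assoc)
    also have "\<dots> = inv z \<otimes> (z \<otimes> s) \<otimes> inv z"
      using z that by simp
    also have "\<dots> = s \<otimes> inv z"
      using z s by (simp add: m_assoc[symmetric])
    finally show ?thesis .
  qed
  then show "inv z \<in> {z \<in> carrier G. \<forall>s\<in>S. z \<otimes> s = s \<otimes> z}" using z by auto
next
  fix a b
  assume ab: "a \<in> {z \<in> carrier G. \<forall>s\<in>S. z \<otimes> s = s \<otimes> z}"
    "b \<in> {z \<in> carrier G. \<forall>s\<in>S. z \<otimes> s = s \<otimes> z}"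
  have "a \<otimes> b \<otimes> s = s \<otimes> (a \<otimes> b)" if "s \<in> S" for s
  proof -
    have s: "s \<in> carrier G" using assms that by auto
    have "a \<otimes> b \<otimes> s = a \<otimes> (s \<otimes> b)" using ab s that by (simp add: m_assoc)
    also have "\<dots> = s \<otimes> a \<otimes> b" using ab s that by (simp add: m_assoc[symmetric])
    finally show ?thesis using ab s by (simp add: m_assoc)
  qed
  then show "a \<otimes> b \<in> {z \<in> carrier G. \<forall>s\<in>S. z \<otimes> s = s \<otimes> z}" using ab by auto
next
  have "\<one> \<in> {z \<in> carrier G. \<forall>s\<in>S. z \<otimes> s = s \<otimes> z}" using assms by auto
  then show "{z \<in> carrier G. \<forall>s\<in>S. z \<otimes> s = s \<otimes> z} \<noteq> {}" by blast
qed auto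

text \<open>
  Two passes through centralizers: by hypothesis the centralizer of the squares contains the squares,
  so it is \<open>G\<close> and the squares are central; then the centre contains the squares, so it is \<open>G\<close> as well.
\<close>

lemma (in group) commuting_squares_imp_commutative:
  assumes gen: "generated_by_squares G"
    and comm: "\<And>x y. x \<in> carrier G \<Longrightarrow> y \<in> carrier G \<Longrightarrow>
      (x \<otimes> x) \<otimes> (y \<otimes> y) = (y \<otimes> y) \<otimes> (x \<otimes> x)"
    and "x \<in> carrier G" "y \<in> carrier G"
  shows "x \<otimes> y = y \<otimes> x"
proof -
  let ?S = "(\<lambda>x. x \<otimes> x) ` carrier G"
  have S: "?S \<subseteq> carrier G" by auto
  have "{z \<in> carrier G. \<forall>s\<in>?S. z \<otimes> s = s \<otimes> z} = carrier G"
    using gen centralizer_subgroup[OF S] comm unfolding generated_by_squares_def by blast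
  then have squares_central: "z \<otimes> (u \<otimes> u) = (u \<otimes> u) \<otimes> z"
    if "z \<in> carrier G" "u \<in> carrier G" for z u
    using that by blast
  have "{z \<in> carrier G. \<forall>s\<in>carrier G. z \<otimes> s = s \<otimes> z} = carrier G"
    using gen centralizer_subgroup[OF subset_refl] squares_central
    unfolding generated_by_squares_def by auto
  with assms show ?thesis by blast
qed

text \<open>
  In an abelian group the squares are closed under products and therefore form a subgroup.
\<close>

lemma (in group) commutative_all_squares:
  assumes gen: "generated_by_squares G"
    and comm: "\<And>x y. x \<in> carrier G \<Longrightarrow> y \<in> carrier G \<Longrightarrow> x \<otimes> y = y \<otimes> x"
    and "g \<in> carrier G"
  obtains r where "r \<in> carrier G" "r \<otimes> r = g"
proof -
  interpret comm_group G by (rule group_comm_groupI) (rule comm)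
  let ?S = "(\<lambda>x. x \<otimes> x) ` carrier G"
  have "subgroup ?S G"
  proof (rule subgroupI)
    fix a b assume "a \<in> ?S" "b \<in> ?S"
    then obtain x y where "x \<in> carrier G" "y \<in> carrier G" "a = x \<otimes> x" "b = y \<otimes> y" by blast
    then show "a \<otimes> b \<in> ?S" by (auto intro!: image_eqI[of _ _ "x \<otimes> y"] simp: m_ac)
  next
    fix a assume "a \<in> ?S"
    then obtain x where "x \<in> carrier G" "a = x \<otimes> x" by blast
    then show "inv a \<in> ?S" by (auto intro!: image_eqI[of _ _ "inv x"] simp: inv_mult_group)
  qed auto
  then have "?S = carrier G"
    using gen unfolding generated_by_squares_def by blast
  with \<open>g \<in> carrier G\<close> have "g \<in> ?S" by simp
  then obtain r where "r \<in> carrier G" "r \<otimes> r = g" by auto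
  then show thesis by (rule that)
qed

section \<open>Maps preserving quotients up to inversion\<close>

text \<open>
  The algebraic content of being an isometry that fixes the unit, for a length function that separates
  elements up to inversion. Below, an element \<open>x\<close> is called fixed if \<open>f x = x\<close> and inverted if
  \<open>f x = x\<inverse>\<close>; elements of order at most 2 are both.
\<close>

locale unsigned_quotient_map = group G for G (structure) +
  fixes f :: "'a \<Rightarrow> 'a"
  assumes closed [simp]: "x \<in> carrier G \<Longrightarrow> f x \<in> carrier G"
    and fix_one [simp]: "f \<one> = \<one>"
    and quotient: "x \<in> carrier G \<Longrightarrow> y \<in> carrier G \<Longrightarrow>
      f x \<otimes> inv f y = x \<otimes> inv y \<or> f x \<otimes> inv f y = inv (x \<otimes> inv y)"
begin

lemma fixed_or_inverted: "x \<in> carrier G \<Longrightarrow> f x = x \<or> f x = inv x"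
  using quotient[of x \<one>] by simp

lemma square_trivial: "x \<in> carrier G \<Longrightarrow> x = inv x \<Longrightarrow> x \<otimes> x = \<one>"
  by (metis r_inv)

text \<open>
  The quotient condition reads \<open>x y = x y\<inverse>\<close> or \<open>x y = y x\<inverse>\<close>. The first alternative would
  give \<open>y\<^sup>2 = 1\<close>; the second says that conjugation by \<open>y\<close> inverts \<open>x\<close>.
\<close>

lemma inverts_fixed:
  assumes [simp]: "x \<in> carrier G" "y \<in> carrier G"
    and "f x = x" "f y = inv y" "y \<otimes> y \<noteq> \<one>"
  shows "y \<otimes> x = inv x \<otimes> y"
proof -
  have "x \<otimes> y = x \<otimes> inv y \<or> x \<otimes> y = y \<otimes> inv x"
    using quotient[of x y] assms by (simp add: inv_mult_group)
  then have "x \<otimes> y = y \<otimes> inv x"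
    using assms square_trivial by (metis Units_eq Units_l_cancel inv_closed)
  then have "inv x \<otimes> (x \<otimes> y) = inv x \<otimes> (y \<otimes> inv x)" by simp
  then have "y = inv x \<otimes> y \<otimes> inv x" by (simp add: m_assoc[symmetric])
  then show ?thesis by (metis assms(1,2) inv_closed inv_inv inv_solve_right m_closed)
qed

text \<open>
  Here the quotient condition reads \<open>x\<inverse> y = y x\<inverse>\<close>, which is commutation, or \<open>x\<inverse> y = x y\<inverse>\<close>,
  which is equality of squares.
\<close>

lemma inverted_commute:
  assumes [simp]: "x \<in> carrier G" "y \<in> carrier G"
    and "f x = inv x" "f y = inv y"
  shows "x \<otimes> y = y \<otimes> x \<or> x \<otimes> x = y \<otimes> y"
proof -
  consider "inv x \<otimes> y = x \<otimes> inv y" | "inv x \<otimes> y = y \<otimes> inv x"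
    using quotient[of x y] assms by (auto simp: inv_mult_group)
  then show ?thesis
  proof cases
    case 1
    have "y \<otimes> y = x \<otimes> (inv x \<otimes> y) \<otimes> y" by (simp add: m_assoc[symmetric])
    also have "\<dots> = x \<otimes> x" by (simp add: 1 m_assoc)
    finally show ?thesis by simp
  next
    case 2
    have "y \<otimes> x = x \<otimes> (inv x \<otimes> y) \<otimes> x" by (simp add: m_assoc[symmetric])
    also have "\<dots> = x \<otimes> y" by (simp add: 2 m_assoc)
    finally show ?thesis by simp
  qed
qed

text \<open>
  Conjugating twice by \<open>y\<close> inverts a fixed element twice. An inverted element commutes with \<open>y\<close> or
  has the same square as \<open>y\<close>, and it commutes with its own square.
\<close>

lemma inverted_square_central:
  assumes [simp]: "y \<in> carrier G" "z \<in> carrier G" and "f y = inv y"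
  shows "(y \<otimes> y) \<otimes> z = z \<otimes> (y \<otimes> y)"
proof (cases "y \<otimes> y = \<one>")
  case False
  show ?thesis
  proof (cases "f z = z")
    case True
    have yz: "y \<otimes> z = inv z \<otimes> y"
      using inverts_fixed[OF _ _ True \<open>f y = inv y\<close> False] by simp
    then have "z \<otimes> (y \<otimes> z) = z \<otimes> (inv z \<otimes> y)" by simp
    then have zyz: "z \<otimes> y \<otimes> z = y" by (simp add: m_assoc[symmetric])
    have "y \<otimes> y \<otimes> z = (z \<otimes> y \<otimes> z) \<otimes> (inv z \<otimes> y)"
      by (simp add: zyz m_assoc yz)
    also have "\<dots> = z \<otimes> (y \<otimes> (z \<otimes> inv z) \<otimes> y)"
      by (simp only: m_assoc assms m_closed inv_closed)
    also have "\<dots> = z \<otimes> (y \<otimes> y)" by simp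
    finally show ?thesis .
  next
    case False
    then have "f z = inv z" using fixed_or_inverted[of z] by simp
    then consider "y \<otimes> z = z \<otimes> y" | "y \<otimes> y = z \<otimes> z"
      using inverted_commute[of y z] assms by auto
    then show ?thesis
    proof cases
      case 1
      then show ?thesis by (metis assms(1,2) m_assoc)
    next
      case 2
      then show ?thesis by (simp add: m_assoc)
    qed
  qed
qed simp

text \<open>
  Since \<open>y\<close> inverts \<open>x'\<close> by conjugation, \<open>y x'\<close> has the same square as \<open>y\<close>. If \<open>y x'\<close> is
  inverted, then conjugation by it inverts \<open>x\<close>, as conjugation by \<open>y\<close> does, so \<open>x'\<close> commutes with
  \<open>x\<close>. If \<open>y x'\<close> is fixed, then conjugation by \<open>y\<close> inverts it, which forces
  \<open>x'\<^sup>2 = (y\<^sup>2)\<inverse>\<close>, and this is central.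
\<close>

lemma fixed_square_commutes:
  assumes [simp]: "x \<in> carrier G" "x' \<in> carrier G" "y \<in> carrier G"
    and x: "f x = x" and x': "f x' = x'" and y: "f y = inv y" "y \<otimes> y \<noteq> \<one>"
  shows "(x' \<otimes> x') \<otimes> x = x \<otimes> (x' \<otimes> x')"
proof -
  have yx': "y \<otimes> x' = inv x' \<otimes> y" and yx: "y \<otimes> x = inv x \<otimes> y"
    using inverts_fixed x x' y by auto
  have "y \<otimes> x' \<otimes> (y \<otimes> x') = (inv x' \<otimes> y) \<otimes> (y \<otimes> x')" by (simp add: yx')
  also have "\<dots> = inv x' \<otimes> ((y \<otimes> y) \<otimes> x')" by (simp add: m_assoc)
  also have "\<dots> = inv x' \<otimes> (x' \<otimes> (y \<otimes> y))"
    using inverted_square_central[of y x'] y by simp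
  finally have square: "y \<otimes> x' \<otimes> (y \<otimes> x') = y \<otimes> y" by (simp add: m_assoc[symmetric])
  consider "f (y \<otimes> x') = inv (y \<otimes> x')" | "f (y \<otimes> x') = y \<otimes> x'"
    using fixed_or_inverted[of "y \<otimes> x'"] by auto
  then show ?thesis
  proof cases
    case 1
    have "y \<otimes> x' \<otimes> x = inv x \<otimes> (y \<otimes> x')"
      using inverts_fixed[OF _ _ x 1] square y(2) by simp
    also have "\<dots> = y \<otimes> x \<otimes> x'" by (simp add: yx m_assoc)
    finally have "x' \<otimes> x = x \<otimes> x'" by (simp add: m_assoc)
    then show ?thesis by (metis assms(1,2) m_assoc)
  next
    case 2
    have "y \<otimes> (y \<otimes> x') = inv (y \<otimes> x') \<otimes> y"
      using inverts_fixed[OF _ _ 2 y(1) y(2)] by simp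
    then have "y \<otimes> y \<otimes> x' = inv x'"
      by (simp add: inv_mult_group m_assoc)
    then have "y \<otimes> y \<otimes> x' \<otimes> inv x' = inv x' \<otimes> inv x'" by simp
    then have "y \<otimes> y = inv (x' \<otimes> x')" by (simp add: m_assoc inv_mult_group)
    then have "x' \<otimes> x' = inv (y \<otimes> y)" by simp
    moreover have "x \<otimes> inv (y \<otimes> y) = inv (y \<otimes> y) \<otimes> x"
    proof -
      have c: "(y \<otimes> y) \<otimes> inv x = inv x \<otimes> (y \<otimes> y)"
        using inverted_square_central[of y "inv x"] y by simp
      have "inv ((y \<otimes> y) \<otimes> inv x) = inv (inv x \<otimes> (y \<otimes> y))" by (simp only: c)
      then show ?thesis by (simp only: inv_mult_group inv_inv assms m_closed inv_closed)
    qed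
    ultimately show ?thesis by simp
  qed
qed

text \<open>
  An inverted element has a central square. Two fixed elements are covered by \<open>fixed_square_commutes\<close>,
  because a moved element \<open>y\<close> is inverted and has \<open>y\<^sup>2 \<noteq> 1\<close>.
\<close>

lemma squares_commute_if_moving:
  assumes [simp]: "x \<in> carrier G" "x' \<in> carrier G" "y \<in> carrier G" and "f y \<noteq> y"
  shows "(x \<otimes> x) \<otimes> (x' \<otimes> x') = (x' \<otimes> x') \<otimes> (x \<otimes> x)"
proof -
  have y: "f y = inv y" using fixed_or_inverted[of y] assms by auto
  have y2: "y \<otimes> y \<noteq> \<one>"
    using y \<open>f y \<noteq> y\<close> inv_equality[of y y] by auto
  consider "f x = inv x" | "f x' = inv x'" | "f x = x" "f x' = x'"
    using fixed_or_inverted[of x] fixed_or_inverted[of x'] by auto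
  then show ?thesis
  proof cases
    case 3
    have "(x' \<otimes> x') \<otimes> x = x \<otimes> (x' \<otimes> x')"
      using fixed_square_commutes[OF _ _ _ 3 y y2] by simp
    then show ?thesis by (metis assms(1,2) m_assoc m_closed)
  qed (use inverted_square_central in auto)
qed

text \<open>
  Once the group is known to be abelian, a fixed element is inverted by conjugation with a
  moved element and also commutes with it, so it equals its own inverse.
\<close>

lemma identity_or_inversion:
  assumes gen: "generated_by_squares G"
  shows "(\<forall>x\<in>carrier G. f x = x) \<or>
    (\<forall>x\<in>carrier G. \<forall>y\<in>carrier G. x \<otimes> y = y \<otimes> x) \<and> (\<forall>x\<in>carrier G. f x = inv x)"
proof (cases "\<forall>x\<in>carrier G. f x = x")
  case False
  then obtain y where y: "y \<in> carrier G" "f y \<noteq> y" by blast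
  have y': "f y = inv y" using fixed_or_inverted y by auto
  have y2: "y \<otimes> y \<noteq> \<one>"
    using y y' inv_equality[of y y] by auto
  have comm: "a \<otimes> b = b \<otimes> a" if "a \<in> carrier G" "b \<in> carrier G" for a b
    using commuting_squares_imp_commutative[OF gen squares_commute_if_moving[OF _ _ y]] that by blast
  have "f x = inv x" if x: "x \<in> carrier G" for x
  proof (rule ccontr)
    assume n: "f x \<noteq> inv x"
    then have fx: "f x = x" using fixed_or_inverted x by auto
    have "x \<otimes> y = inv x \<otimes> y"
      using inverts_fixed[OF x y(1) fx y' y2] comm x y(1) by simp
    then have "x = inv x" using x y(1) by simp
    with n fx show False by simp
  qed
  with comm show ?thesis by blast
qed simp

end

section \<open>Metrics that separate elements up to inversion\<close>

text \<open>
  Composing \<open>F\<close> with the right translation by \<open>(F 1)\<inverse>\<close> gives an isometry that fixes the unit.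
\<close>

lemma (in group) isometry_cases:
  assumes gen: "generated_by_squares G"
    and lgen: "\<And>x y. x \<in> carrier G \<Longrightarrow> y \<in> carrier G \<Longrightarrow> l x = l y \<Longrightarrow> x = y \<or> x = inv y"
    and d: "\<And>x y. x \<in> carrier G \<Longrightarrow> y \<in> carrier G \<Longrightarrow> d x y = l (x \<otimes> inv y)"
    and F: "isometry_on (carrier G) d F"
  shows "(\<forall>x\<in>carrier G. F x = x \<otimes> F \<one>) \<or>
    (\<forall>x\<in>carrier G. \<forall>y\<in>carrier G. x \<otimes> y = y \<otimes> x) \<and> (\<forall>x\<in>carrier G. F x = inv x \<otimes> F \<one>)"
proof -
  have Fc [simp]: "F x \<in> carrier G" if "x \<in> carrier G" for x
    using F that unfolding isometry_on_def by (meson bij_betwE)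
  define f where "f x = F x \<otimes> inv F \<one>" for x
  have F_eq: "F x = f x \<otimes> F \<one>" if "x \<in> carrier G" for x
    using that by (simp add: f_def m_assoc)
  have "unsigned_quotient_map G f"
  proof
    fix x y assume xy [simp]: "x \<in> carrier G" "y \<in> carrier G"
    have "f x \<otimes> inv f y = F x \<otimes> (inv F \<one> \<otimes> F \<one>) \<otimes> inv F y"
      by (simp only: f_def inv_mult_group m_assoc inv_inv xy Fc one_closed m_closed inv_closed)
    then have q: "f x \<otimes> inv f y = F x \<otimes> inv F y" by simp
    have "l (F x \<otimes> inv F y) = l (x \<otimes> inv y)"
      using F xy d unfolding isometry_on_def by (metis Fc)
    then have "F x \<otimes> inv F y = x \<otimes> inv y \<or> F x \<otimes> inv F y = inv (x \<otimes> inv y)"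
      by (intro lgen) auto
    with q show "f x \<otimes> inv f y = x \<otimes> inv y \<or> f x \<otimes> inv f y = inv (x \<otimes> inv y)" by simp
  qed (auto simp: f_def)
  then interpret f: unsigned_quotient_map G f .
  from f.identity_or_inversion[OF gen] F_eq show ?thesis by metis
qed

text \<open>
  The hypothesis says that right translation by \<open>h\<close> in \<open>H\<close> is right translation in \<open>G\<close> by some
  element; evaluating at the unit of \<open>G\<close> shows that this element is \<open>\<phi> h = 1 \<circ> h\<close>, where \<open>\<circ>\<close>
  is the product of \<open>H\<close>. Composition of translations makes \<open>\<phi>\<close> a homomorphism. The units of \<open>H\<close> and
  \<open>G\<close> may differ, so \<open>\<phi>\<close> is in general not the identity: evaluating at the unit \<open>e\<close> of \<open>H\<close> gives
  \<open>h = e \<phi> h\<close>.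
\<close>

lemma (in group) iso_if_right_translations_agree:
  assumes H: "group H" and c: "carrier H = carrier G"
    and tr: "\<And>h x. h \<in> carrier G \<Longrightarrow> x \<in> carrier G \<Longrightarrow> x \<otimes>\<^bsub>H\<^esub> h = x \<otimes> (\<one> \<otimes>\<^bsub>H\<^esub> h)"
  shows "H \<cong> G"
proof -
  interpret H: group H by fact
  define \<phi> where "\<phi> h = \<one> \<otimes>\<^bsub>H\<^esub> h" for h
  have Hc: "x \<otimes>\<^bsub>H\<^esub> y \<in> carrier G" if "x \<in> carrier G" "y \<in> carrier G" for x y
    using H.m_closed that c by auto
  have \<phi>c: "\<phi> h \<in> carrier G" if "h \<in> carrier G" for h using Hc that by (simp add: \<phi>_def)
  have e: "\<one>\<^bsub>H\<^esub> \<in> carrier G" using H.one_closed c by simp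
  have \<phi>: "h = \<one>\<^bsub>H\<^esub> \<otimes> \<phi> h" if "h \<in> carrier G" for h
    using tr[OF that e] H.l_one that c by (simp add: \<phi>_def)
  have "\<phi> \<in> hom H G"
  proof (rule homI)
    fix x y assume "x \<in> carrier H" "y \<in> carrier H"
    then have xy: "x \<in> carrier G" "y \<in> carrier G" using c by auto
    have "\<phi> (x \<otimes>\<^bsub>H\<^esub> y) = \<phi> x \<otimes>\<^bsub>H\<^esub> y"
      unfolding \<phi>_def using H.m_assoc[of \<one> x y] xy c by simp
    also have "\<dots> = \<phi> x \<otimes> \<phi> y" using tr[OF xy(2) \<phi>c[OF xy(1)]] by (simp add: \<phi>_def)
    finally show "\<phi> (x \<otimes>\<^bsub>H\<^esub> y) = \<phi> x \<otimes> \<phi> y" .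
  qed (use \<phi>c c in auto)
  moreover have "bij_betw \<phi> (carrier H) (carrier G)"
  proof (rule bij_betw_imageI)
    show "inj_on \<phi> (carrier H)" by (rule inj_onI) (metis \<phi> c)
    show "\<phi> ` carrier H = carrier G"
    proof (intro equalityI subsetI)
      fix g assume g: "g \<in> carrier G"
      then have h: "\<one>\<^bsub>H\<^esub> \<otimes> g \<in> carrier G" using e by simp
      have "\<phi> (\<one>\<^bsub>H\<^esub> \<otimes> g) = g" using \<phi>[OF h] e g \<phi>c[OF h] by simp
      then show "g \<in> \<phi> ` carrier H" using h c by force
    qed (use \<phi>c c in auto)
  qed
  ultimately show ?thesis by (auto simp: is_iso_def iso_def)
qed


text \<open>
  The values off the unit lie in \<open>[4, 8]\<close> because \<open>arctan\<close> squeezes the real line injectively into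
  an interval of length less than 4 around 0.
\<close>

lemma (in group) length_function_exists:
  fixes \<iota> :: "'a \<Rightarrow> real"
  assumes "inj_on \<iota> (carrier G)"
  obtains l :: "'a \<Rightarrow> real" where "l \<one> = 0"
    "\<And>x. x \<in> carrier G \<Longrightarrow> l (inv x) = l x"
    "\<And>x. x \<in> carrier G \<Longrightarrow> x \<noteq> \<one> \<Longrightarrow> 4 \<le> l x \<and> l x \<le> 8"
    "\<And>x y. x \<in> carrier G \<Longrightarrow> y \<in> carrier G \<Longrightarrow> l x = l y \<Longrightarrow> x = y \<or> x = inv y"
proof -
  \<comment> \<open>A representative of the pair \<open>{x, inv x}\<close>: it depends on the set only, so
      \<open>x\<close> and \<open>inv x\<close> share it.\<close>
  define c where "c x = (SOME z. z \<in> {x, inv x})" for x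
  define l where "l x = (if x = \<one> then 0 else 6 + arctan (\<iota> (c x)))" for x
  have c: "c x \<in> {x, inv x}" for x
    unfolding c_def by (rule someI[of _ x]) simp
  have bound: "4 \<le> 6 + arctan r \<and> 6 + arctan r \<le> 8" for r
    using arctan_bounded[of r] pi_half_less_two by linarith
  have zero: "l x = 0 \<longleftrightarrow> x = \<one>" for x
    using bound[of "\<iota> (c x)"] by (simp add: l_def)
  show thesis
  proof (rule that[of l])
    show "l \<one> = 0" by (simp add: l_def)
    show "4 \<le> l x \<and> l x \<le> 8" if "x \<in> carrier G" "x \<noteq> \<one>" for x
      using bound that by (simp add: l_def)
    show "l (inv x) = l x" if "x \<in> carrier G" for x
    proof -
      have "c (inv x) = c x" using that by (simp add: c_def insert_commute)
      then show ?thesis using that by (simp add: l_def)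
    qed
    show "x = y \<or> x = inv y" if xy: "x \<in> carrier G" "y \<in> carrier G" and eq: "l x = l y" for x y
    proof (cases "x = \<one> \<or> y = \<one>")
      case True
      then have "x = y" using eq zero by metis
      then show ?thesis ..
    next
      case False
      then have "\<iota> (c x) = \<iota> (c y)" using eq by (simp add: l_def arctan_eq_iff)
      moreover have "c x \<in> carrier G" "c y \<in> carrier G" using c[of x] c[of y] xy by auto
      ultimately have "c x = c y" using assms by (auto dest: inj_onD)
      then show ?thesis using c[of x] c[of y] xy by (metis empty_iff insert_iff inv_inv)
    qed
  qed
qed

lemma (in group) length_function_metric:
  fixes l :: "'a \<Rightarrow> real"
  assumes one: "l \<one> = 0" and sym: "\<And>x. x \<in> carrier G \<Longrightarrow> l (inv x) = l x"
    and range: "\<And>x. x \<in> carrier G \<Longrightarrow> x \<noteq> \<one> \<Longrightarrow> 4 \<le> l x \<and> l x \<le> 8"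
  shows "Metric_space (carrier G)
    (\<lambda>x y. if x \<in> carrier G \<and> y \<in> carrier G then l (x \<otimes> inv y) else 0)"
    (is "Metric_space _ ?d")
proof
  have nonneg: "0 \<le> l x" if "x \<in> carrier G" for x using one range[of x] that by force
  show "0 \<le> ?d x y" for x y using nonneg by simp
  show "?d x y = ?d y x" for x y
    using sym[of "x \<otimes> inv y"] by (auto simp: inv_mult_group)
  \<comment> \<open>Nothing but the unit has length 0, so for three distinct points each of the three distances
      is in \<open>[4, 8]\<close>.\<close>
  have eq: "x \<otimes> inv y = \<one> \<longleftrightarrow> x = y" if "x \<in> carrier G" "y \<in> carrier G" for x y
    using that inv_equality[of x "inv y"] by auto
  show "?d x y = 0 \<longleftrightarrow> x = y" if "x \<in> carrier G" "y \<in> carrier G" for x y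
    using that eq[of x y] range[of "x \<otimes> inv y"] one by (cases "x = y") auto
  show "?d x z \<le> ?d x y + ?d y z"
    if "x \<in> carrier G" "y \<in> carrier G" "z \<in> carrier G" for x y z
  proof (cases "x = y \<or> y = z \<or> x = z")
    case True
    then show ?thesis using that nonneg one by auto
  next
    case False
    then show ?thesis
      using that range[of "x \<otimes> inv y"] range[of "y \<otimes> inv z"] range[of "x \<otimes> inv z"] eq by auto
  qed
qed

text \<open>
  The case of \<open>isometry_cases\<close> to be excluded for a right translation of \<open>H\<close> is \<open>x \<mapsto> x\<inverse> g\<close> on
  an abelian group. It has the fixed point \<open>r\<close> with \<open>r\<^sup>2 = g\<close>, and by cancellation in \<open>H\<close> only the
  translation by the unit of \<open>H\<close> has a fixed point. That one is the identity, hence a right translation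
  of \<open>G\<close> after all.
\<close>

theorem natural_group_if_generated_by_squares:
  fixes \<iota> :: "'a \<Rightarrow> real"
  assumes "group G" and gen: "generated_by_squares G" and inj: "inj_on \<iota> (carrier G)"
  shows "natural_group G"
proof -
  interpret group G by fact
  obtain l :: "'a \<Rightarrow> real" where one: "l \<one>\<^bsub>G\<^esub> = 0"
    and sym: "\<And>x. x \<in> carrier G \<Longrightarrow> l (inv\<^bsub>G\<^esub> x) = l x"
    and range: "\<And>x. x \<in> carrier G \<Longrightarrow> x \<noteq> \<one>\<^bsub>G\<^esub> \<Longrightarrow> 4 \<le> l x \<and> l x \<le> 8"
    and sep: "\<And>x y. x \<in> carrier G \<Longrightarrow> y \<in> carrier G \<Longrightarrow> l x = l y \<Longrightarrow> x = y \<or> x = inv\<^bsub>G\<^esub> y"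
    by (rule length_function_exists[OF inj]) blast
  \<comment> \<open>Metrics have to be nonnegative and symmetric outside the carrier as well, hence the
      default value 0.\<close>
  define d where
    "d x y = (if x \<in> carrier G \<and> y \<in> carrier G then l (x \<otimes>\<^bsub>G\<^esub> inv\<^bsub>G\<^esub> y) else 0)" for x y
  have d: "d x y = l (x \<otimes>\<^bsub>G\<^esub> inv\<^bsub>G\<^esub> y)" if "x \<in> carrier G" "y \<in> carrier G" for x y
    using that by (simp add: d_def)
  have "Metric_space (carrier G) d"
    unfolding d_def by (rule length_function_metric[where l = l, OF one sym range])
  moreover have "right_translations_isometric G d"
    unfolding right_translations_isometric_def isometry_on_def
  proof (intro ballI conjI)
    fix g assume g: "g \<in> carrier G"
    show "bij_betw (\<lambda>x. x \<otimes>\<^bsub>G\<^esub> g) (carrier G) (carrier G)"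
      by (rule bij_betw_byWitness[where f' = "\<lambda>x. x \<otimes>\<^bsub>G\<^esub> inv\<^bsub>G\<^esub> g"]) (use g in \<open>auto simp: m_assoc\<close>)
    fix x y assume xy: "x \<in> carrier G" "y \<in> carrier G"
    have "x \<otimes>\<^bsub>G\<^esub> g \<otimes>\<^bsub>G\<^esub> inv\<^bsub>G\<^esub> (y \<otimes>\<^bsub>G\<^esub> g) = x \<otimes>\<^bsub>G\<^esub> (g \<otimes>\<^bsub>G\<^esub> inv\<^bsub>G\<^esub> g) \<otimes>\<^bsub>G\<^esub> inv\<^bsub>G\<^esub> y"
      by (simp only: inv_mult_group m_assoc xy g m_closed inv_closed)
    then show "d (x \<otimes>\<^bsub>G\<^esub> g) (y \<otimes>\<^bsub>G\<^esub> g) = d x y" using xy g by (simp add: d)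
  qed
  moreover have "H \<cong> G"
    if "group H" and c: "carrier H = carrier G" and iso: "right_translations_isometric H d"
    for H :: "'a monoid"
  proof (rule iso_if_right_translations_agree[OF \<open>group H\<close> c])
    interpret H: group H by fact
    fix h x assume h: "h \<in> carrier G" and x: "x \<in> carrier G"
    let ?R = "\<lambda>x. x \<otimes>\<^bsub>H\<^esub> h"
    have isoh: "isometry_on (carrier G) d ?R"
      using iso h c unfolding right_translations_isometric_def by auto
    have cases: "(\<forall>x\<in>carrier G. ?R x = x \<otimes>\<^bsub>G\<^esub> ?R \<one>\<^bsub>G\<^esub>) \<or>
      (\<forall>x\<in>carrier G. \<forall>y\<in>carrier G. x \<otimes>\<^bsub>G\<^esub> y = y \<otimes>\<^bsub>G\<^esub> x) \<and>
      (\<forall>x\<in>carrier G. ?R x = inv\<^bsub>G\<^esub> x \<otimes>\<^bsub>G\<^esub> ?R \<one>\<^bsub>G\<^esub>)"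
      by (rule isometry_cases[where d = d and l = l, OF gen sep d isoh])
    then show "x \<otimes>\<^bsub>H\<^esub> h = x \<otimes>\<^bsub>G\<^esub> (\<one>\<^bsub>G\<^esub> \<otimes>\<^bsub>H\<^esub> h)"
    proof (elim disjE conjE)
      assume comm: "\<forall>x\<in>carrier G. \<forall>y\<in>carrier G. x \<otimes>\<^bsub>G\<^esub> y = y \<otimes>\<^bsub>G\<^esub> x"
        and R: "\<forall>x\<in>carrier G. x \<otimes>\<^bsub>H\<^esub> h = inv\<^bsub>G\<^esub> x \<otimes>\<^bsub>G\<^esub> (\<one>\<^bsub>G\<^esub> \<otimes>\<^bsub>H\<^esub> h)"
      let ?g = "\<one>\<^bsub>G\<^esub> \<otimes>\<^bsub>H\<^esub> h"
      have g: "?g \<in> carrier G" using H.m_closed[of "\<one>\<^bsub>G\<^esub>" h] h c by simp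
      obtain r where r: "r \<in> carrier G" "r \<otimes>\<^bsub>G\<^esub> r = ?g"
        using commutative_all_squares[OF gen _ g] comm by metis
      have "r \<otimes>\<^bsub>H\<^esub> h = inv\<^bsub>G\<^esub> r \<otimes>\<^bsub>G\<^esub> (r \<otimes>\<^bsub>G\<^esub> r)"
        using bspec[OF R r(1)] by (simp only: r(2))
      also have "\<dots> = r" using r(1) by (simp add: m_assoc[symmetric])
      finally have "h = \<one>\<^bsub>H\<^esub>"
        using H.l_cancel_one[of r h] r(1) h c by simp
      then show ?thesis using H.r_one x c by simp
    qed (use x in blast)
  qed
  ultimately show ?thesis
    using \<open>group G\<close> unfolding natural_group_def by blast
qed

section \<open>Squares near the unit of a Lie group\<close>

text \<open>
  The multiplication of a Lie group in a chart around the unit \<open>p\<close>. The unit laws force the partial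
  derivatives at \<open>(p, p)\<close> to be the identity on \<open>V\<close>, so \<open>x \<mapsto> F (x, x)\<close> has derivative
  \<open>v \<mapsto> 2 v\<close> there, and a map with invertible derivative at a point covers a neighbourhood of its
  value. As \<open>V\<close> may be a proper subspace, everything is first extended to an open subset of the
  ambient space by a linear projection \<open>P\<close> onto \<open>V\<close>, where derivatives are unique.
\<close>

lemma square_map_covers_neighbourhood:
  fixes F :: "'e::euclidean_space \<times> 'e \<Rightarrow> 'e"
  assumes V: "subspace V" and \<Omega>: "openin (top_of_set V) \<Omega>" and p: "p \<in> \<Omega>"
    and S: "\<Omega> \<times> \<Omega> \<subseteq> S"
    and contF: "continuous_on S F"
    and D: "(F has_derivative D) (at (p, p) within S)"
    and unit: "\<And>x. x \<in> \<Omega> \<Longrightarrow> F (x, p) = x" "\<And>x. x \<in> \<Omega> \<Longrightarrow> F (p, x) = x"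
    and FV: "\<And>x. x \<in> \<Omega> \<Longrightarrow> F (x, x) \<in> V"
  obtains B where "open B" "p \<in> B" "B \<inter> V \<subseteq> (\<lambda>x. F (x, x)) ` \<Omega>"
proof -
  obtain P where PV: "range P \<subseteq> V" and "linear P" and Pid: "\<And>v. v \<in> V \<Longrightarrow> P v = v"
    using linear_exists_left_inverse_on[OF linear_id V, of] by (auto simp: inj_on_def)
  then have P: "bounded_linear P" by (simp add: linear_conv_bounded_linear)
  interpret P: bounded_linear P by (rule P)
  interpret D: bounded_linear D by (rule has_derivative_bounded_linear[OF D])
  have PP [simp]: "P (P x) = P x" for x using PV Pid by auto
  have "\<Omega> \<subseteq> V" using \<Omega> openin_imp_subset by auto
  with p have Pp: "P p = p" using Pid by blast
  define U where "U = P -` \<Omega>"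
  have "open U"
  proof -
    obtain W where W: "open W" "\<Omega> = V \<inter> W" using \<Omega> by (auto simp: openin_open)
    then have "U = P -` W" using PV by (auto simp: U_def)
    then show ?thesis using open_vimage[OF W(1) P.continuous_on[OF continuous_on_id]] by simp
  qed
  have pU: "p \<in> U" using p Pp by (simp add: U_def)
  have dP: "(P has_derivative P) (at p within X)" for X
    by (rule P.has_derivative) (rule has_derivative_ident)
  have chain: "((\<lambda>x. F (a x)) has_derivative (\<lambda>v. D (a' v))) (at p)"
    if a: "(a has_derivative a') (at p within U)" and "a ` U \<subseteq> S" "a p = (p, p)" for a a'
  proof -
    have "((\<lambda>x. F (a x)) has_derivative (\<lambda>v. D (a' v))) (at p within U)"
      by (rule has_derivative_in_compose[OF a])
        (use that D in \<open>auto intro: has_derivative_subset\<close>)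
    then show ?thesis by (simp only: at_within_open[OF pU \<open>open U\<close>])
  qed
  have transform: "(P has_derivative g') (at p)"
    if "(g has_derivative g') (at p)" "\<And>x. x \<in> U \<Longrightarrow> g x = P x" for g g'
    using has_derivative_transform_within_open[OF that(1) \<open>open U\<close> pU] that(2) by blast
  have "((\<lambda>x. F (P x, p)) has_derivative (\<lambda>v. D (P v, 0))) (at p)"
    by (rule chain[of "\<lambda>x. (P x, p)" "\<lambda>v. (P v, 0)"])
      (use S p Pp in \<open>auto simp: U_def intro!: has_derivative_Pair dP has_derivative_const\<close>)
  then have "(P has_derivative (\<lambda>v. D (P v, 0))) (at p)"
    by (rule transform) (simp add: unit U_def)
  then have D1: "D (P v, 0) = P v" for v
    using has_derivative_unique[OF _ dP] by metis
  have "((\<lambda>x. F (p, P x)) has_derivative (\<lambda>v. D (0, P v))) (at p)"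
    by (rule chain[of "\<lambda>x. (p, P x)" "\<lambda>v. (0, P v)"])
      (use S p Pp in \<open>auto simp: U_def intro!: has_derivative_Pair dP has_derivative_const\<close>)
  then have "(P has_derivative (\<lambda>v. D (0, P v))) (at p)"
    by (rule transform) (simp add: unit U_def)
  then have D2: "D (0, P v) = P v" for v
    using has_derivative_unique[OF _ dP] by metis
  have DPP: "D (P v, P v) = P v + P v" for v
    using D.add[of "(P v, 0)" "(0, P v)"] D1 D2 by simp
  \<comment> \<open>Acts as the squaring map along \<open>V\<close> and as the identity along the kernel of \<open>P\<close>, so its
      derivative \<open>v + P v\<close> is invertible on the whole space, with inverse \<open>w - P w / 2\<close>.\<close>
  define g where "g x = F (P x, P x) + (x - P x)" for x
  have "((\<lambda>x. F (P x, P x)) has_derivative (\<lambda>v. D (P v, P v))) (at p)"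
    by (rule chain[of "\<lambda>x. (P x, P x)" "\<lambda>v. (P v, P v)"])
      (use S Pp in \<open>auto simp: U_def intro!: has_derivative_Pair dP\<close>)
  then have "(g has_derivative (\<lambda>v. D (P v, P v) + (v - P v))) (at p)"
    unfolding g_def by (intro derivative_intros dP)
  then have dg: "(g has_derivative (\<lambda>v. v + P v)) (at p)" by (simp add: DPP add.commute)
  have "continuous_on U (\<lambda>x. F (P x, P x))"
    by (rule continuous_on_compose2[OF contF])
      (use S in \<open>auto simp: U_def intro!: continuous_intros P.continuous_on\<close>)
  then have contg: "continuous_on U g"
    unfolding g_def by (intro continuous_intros P.continuous_on)
  have inverse: "bounded_linear (\<lambda>w. w - (1/2) *\<^sub>R P w)"
    by (intro bounded_linear_sub bounded_linear_ident bounded_linear_const_scaleR P)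
  have "(\<lambda>v. v + P v) \<circ> (\<lambda>w. w - (1/2) *\<^sub>R P w) = id"
    by (rule ext) (simp add: P.diff P.scaleR algebra_simps flip: scaleR_add_left)
  with inverse have "g p \<in> interior (g ` U)"
    using sussmann_open_mapping[OF \<open>open U\<close> contg pU dg, of _ U] \<open>open U\<close> pU
    by (simp add: interior_open)
  moreover have "g p = p" by (simp add: g_def Pp unit p)
  moreover have "interior (g ` U) \<inter> V \<subseteq> (\<lambda>x. F (x, x)) ` \<Omega>"
  proof
    \<comment> \<open>Applying \<open>P\<close> to \<open>v = g x\<close> kills the component \<open>x - P x\<close> in the kernel.\<close>
    fix v assume v: "v \<in> interior (g ` U) \<inter> V"
    then obtain x where x: "x \<in> U" "v = g x" using interior_subset by blast
    then have "P (F (P x, P x)) = F (P x, P x)" using FV Pid by (simp add: U_def)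
    moreover have "P v = v" using v Pid by blast
    ultimately have "v = F (P x, P x)" using x by (simp add: g_def P.add P.diff)
    then show "v \<in> (\<lambda>x. F (x, x)) ` \<Omega>" using x(1) by (auto simp: U_def)
  qed
  ultimately show thesis using that[of "interior (g ` U)"] by simp
qed

text \<open>
  A subgroup \<open>K\<close> containing the neighbourhood \<open>N\<close> of the unit is open and closed: on the neighbourhood
  \<open>N a\<close> of a point \<open>a\<close>, membership in \<open>K\<close> is constant.
\<close>

lemma generated_by_squares_if_neighbourhood_of_squares:
  assumes "group G" and top: "topspace T = carrier G" and conn: "connected_space T"
    and cont: "\<And>g. g \<in> carrier G \<Longrightarrow> continuous_map T T (\<lambda>x. x \<otimes>\<^bsub>G\<^esub> g)"
    and N: "openin T N" "\<one>\<^bsub>G\<^esub> \<in> N" "N \<subseteq> (\<lambda>x. x \<otimes>\<^bsub>G\<^esub> x) ` carrier G"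
  shows "generated_by_squares G"
  unfolding generated_by_squares_def
proof (intro allI impI)
  interpret group G by fact
  fix K assume K: "subgroup K G" and sq: "\<forall>x\<in>carrier G. x \<otimes>\<^bsub>G\<^esub> x \<in> K"
  have KG: "K \<subseteq> carrier G" using K by (rule subgroup.subset)
  have NK: "N \<subseteq> K" using N(3) sq by blast
  have nbhd: "\<exists>W. openin T W \<and> a \<in> W \<and> (\<forall>x\<in>W. x \<in> K \<longleftrightarrow> a \<in> K)" if a: "a \<in> carrier G" for a
  proof (intro exI conjI)
    let ?W = "{x \<in> topspace T. x \<otimes>\<^bsub>G\<^esub> inv\<^bsub>G\<^esub> a \<in> N}"
    show "openin T ?W" using openin_continuous_map_preimage[OF cont N(1)] a by simp
    show "a \<in> ?W" using a N(2) top by simp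
    show "\<forall>x\<in>?W. x \<in> K \<longleftrightarrow> a \<in> K"
    proof
      fix x assume x: "x \<in> ?W"
      then have xc: "x \<in> carrier G" and xa: "x \<otimes>\<^bsub>G\<^esub> inv\<^bsub>G\<^esub> a \<in> K" using top NK by auto
      have 1: "x = x \<otimes>\<^bsub>G\<^esub> inv\<^bsub>G\<^esub> a \<otimes>\<^bsub>G\<^esub> a" using xc a by (simp add: m_assoc)
      have 2: "a = inv\<^bsub>G\<^esub> (x \<otimes>\<^bsub>G\<^esub> inv\<^bsub>G\<^esub> a) \<otimes>\<^bsub>G\<^esub> x" using xc a by (simp add: m_assoc inv_mult_group)
      show "x \<in> K \<longleftrightarrow> a \<in> K"
        using 1 2 xa subgroup.m_closed[OF K] subgroup.m_inv_closed[OF K] by metis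
    qed
  qed
  have "openin T K" unfolding openin_subopen[of T K]
    using nbhd KG by (metis (no_types, lifting) subsetD subsetI)
  moreover have "openin T (topspace T - K)" unfolding openin_subopen[of T "topspace T - K"]
  proof
    fix a assume a: "a \<in> topspace T - K"
    then obtain W where W: "openin T W" "a \<in> W" "\<forall>x\<in>W. x \<in> K \<longleftrightarrow> a \<in> K"
      using nbhd[of a] top by auto
    with a openin_subset[OF W(1)] show "\<exists>W. openin T W \<and> a \<in> W \<and> W \<subseteq> topspace T - K" by blast
  qed
  ultimately have "K = {} \<or> K = topspace T"
    using conn KG top unfolding connected_space_clopen_in closedin_def by blast
  then show "K = carrier G" using subgroup.one_closed[OF K] top by auto
qed

text \<open>
  The hypotheses of \<open>square_map_covers_neighbourhood\<close> hold for the product \<open>F\<close> written in a chart at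
  the unit. \<open>F\<close> makes sense only for pairs in \<open>U \<times> U\<close> whose product stays in \<open>U\<close>, so the chart domain
  is shrunk to a \<open>W\<close> with \<open>W W \<subseteq> U\<close>. A chart value close to that of the unit is then the value of a
  square, and charts are injective.
\<close>

lemma lie_group_neighbourhood_of_squares:
  assumes "lie_group G T V A"
  obtains N where "openin T N" "\<one>\<^bsub>G\<^esub> \<in> N" "N \<subseteq> (\<lambda>x. x \<otimes>\<^bsub>G\<^esub> x) ` carrier G"
proof -
  let ?mult = "\<lambda>(x, y). x \<otimes>\<^bsub>G\<^esub> y"
  from assms have "group G" and top: "topspace T = carrier G" and "smooth_manifold T V A"
    and smooth: "smooth_map (prod_topology T T) (V \<times> V) (prod_atlas A A) T A ?mult"
    unfolding lie_group_def by auto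
  then have V: "subspace V" and atlas: "smooth_atlas T V A"
    unfolding smooth_manifold_def by auto
  interpret group G by fact
  have "\<one>\<^bsub>G\<^esub> \<in> \<Union> (fst ` A)"
    using atlas top unfolding smooth_atlas_def by auto
  then obtain U \<phi> where chart: "(U, \<phi>) \<in> A" and oneU: "\<one>\<^bsub>G\<^esub> \<in> U" by fastforce
  have "is_chart T V (U, \<phi>)" using atlas chart unfolding smooth_atlas_def by blast
  then have U: "openin T U" and imU: "openin (top_of_set V) (\<phi> ` U)"
    and homeo: "homeomorphic_map (subtopology T U) (top_of_set (\<phi> ` U)) \<phi>"
    unfolding is_chart_def by auto
  have UG: "U \<subseteq> carrier G" using openin_subset[OF U] top by simp
  have inj: "inj_on \<phi> U"
    using homeomorphic_imp_injective_map[OF homeo] UG top by (simp add: Int_absorb1)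
  have cont: "continuous_map (prod_topology T T) T ?mult"
    using smooth unfolding smooth_map_def by blast
  define S where "S = map_prod \<phi> \<phi> ` {z \<in> U \<times> U. ?mult z \<in> U}"
  define F where "F = \<phi> \<circ> ?mult \<circ> inv_into (U \<times> U) (map_prod \<phi> \<phi>)"
  have F: "F (\<phi> x, \<phi> y) = \<phi> (x \<otimes>\<^bsub>G\<^esub> y)" if "x \<in> U" "y \<in> U" for x y
    using inv_into_f_f[OF map_prod_inj_on[OF inj inj], of "(x, y)"] that by (simp add: F_def)
  have "(U \<times> U, map_prod \<phi> \<phi>) \<in> prod_atlas A A"
    using chart unfolding prod_atlas_def by force
  then have smoothF: "smooth_on (V \<times> V) S F"
    using smooth chart unfolding smooth_map_def S_def F_def by blast
  have contF: "continuous_on S F"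
    using smoothF Ck_on.simps(1) unfolding smooth_on_def by blast
  obtain D where D: "\<And>z. z \<in> S \<Longrightarrow> (F has_derivative D z) (at z within S)"
    using smoothF[unfolded smooth_on_def, rule_format, of "Suc 0"] by auto
  obtain W where W: "openin T W" "\<one>\<^bsub>G\<^esub> \<in> W" "W \<subseteq> U"
    and WW: "\<And>x y. x \<in> W \<Longrightarrow> y \<in> W \<Longrightarrow> x \<otimes>\<^bsub>G\<^esub> y \<in> U"
  proof -
    let ?P = "{z \<in> topspace (prod_topology T T). ?mult z \<in> U}"
    have "openin (prod_topology T T) ?P" by (rule openin_continuous_map_preimage[OF cont U])
    moreover have "(\<one>\<^bsub>G\<^esub>, \<one>\<^bsub>G\<^esub>) \<in> ?P" using oneU top by simp
    ultimately obtain X Y where XY: "openin T X" "openin T Y" "\<one>\<^bsub>G\<^esub> \<in> X" "\<one>\<^bsub>G\<^esub> \<in> Y" "X \<times> Y \<subseteq> ?P"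
      unfolding openin_prod_topology_alt by meson
    show thesis
    proof (rule that[of "X \<inter> Y \<inter> U"])
      show "openin T (X \<inter> Y \<inter> U)" using XY(1,2) U by (intro openin_Int)
      show "x \<otimes>\<^bsub>G\<^esub> y \<in> U" if "x \<in> X \<inter> Y \<inter> U" "y \<in> X \<inter> Y \<inter> U" for x y
        using subsetD[OF XY(5), of "(x, y)"] that by simp
    qed (use XY(3,4) oneU in auto)
  qed
  have "openin (subtopology T U) W" using W U by (simp add: openin_open_subtopology)
  then have "openin (top_of_set (\<phi> ` U)) (\<phi> ` W)"
    using homeomorphic_imp_open_map[OF homeo] unfolding open_map_def by blast
  then have imW: "openin (top_of_set V) (\<phi> ` W)" using imU by (rule openin_trans)
  have WS: "\<phi> ` W \<times> \<phi> ` W \<subseteq> S"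
  proof
    fix z assume "z \<in> \<phi> ` W \<times> \<phi> ` W"
    then obtain x y where "x \<in> W" "y \<in> W" "z = map_prod \<phi> \<phi> (x, y)" by auto
    then show "z \<in> S" using WW W(3) by (auto simp: S_def intro!: imageI)
  qed
  have p: "\<phi> \<one>\<^bsub>G\<^esub> \<in> \<phi> ` W" using W(2) by (rule imageI)
  have pp: "(\<phi> \<one>\<^bsub>G\<^esub>, \<phi> \<one>\<^bsub>G\<^esub>) \<in> S" using WS p by blast
  have imUV: "\<phi> ` U \<subseteq> V" using imU by (rule openin_imp_subset)
  obtain B where B: "open B" "\<phi> \<one>\<^bsub>G\<^esub> \<in> B" "B \<inter> V \<subseteq> (\<lambda>x. F (x, x)) ` (\<phi> ` W)"
  proof (rule square_map_covers_neighbourhood[OF V imW p WS contF D[OF pp]])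
    fix q assume "q \<in> \<phi> ` W"
    then obtain x where x: "x \<in> W" "q = \<phi> x" by blast
    then have xU: "x \<in> U" and xG: "x \<in> carrier G" using W(3) UG by auto
    show "F (q, \<phi> \<one>\<^bsub>G\<^esub>) = q" "F (\<phi> \<one>\<^bsub>G\<^esub>, q) = q"
      using x(2) F xU oneU xG by simp_all
    show "F (q, q) \<in> V" using x F xU WW imUV by auto
  qed
  show thesis
  proof (rule that[of "{x \<in> topspace (subtopology T U). \<phi> x \<in> \<phi> ` U \<inter> B}"])
    let ?N = "{x \<in> topspace (subtopology T U). \<phi> x \<in> \<phi> ` U \<inter> B}"
    have "openin (top_of_set (\<phi> ` U)) (\<phi> ` U \<inter> B)" using B(1) by (rule openin_open_Int)
    then have "openin (subtopology T U) ?N"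
      by (rule openin_continuous_map_preimage[OF homeomorphic_imp_continuous_map[OF homeo]])
    then show "openin T ?N" using U openin_trans_full by blast
    show "\<one>\<^bsub>G\<^esub> \<in> ?N" using oneU top B(2) by simp
    show "?N \<subseteq> (\<lambda>x. x \<otimes>\<^bsub>G\<^esub> x) ` carrier G"
    proof
      fix x assume "x \<in> ?N"
      then have x: "x \<in> U" "\<phi> x \<in> B" by auto
      then have "\<phi> x \<in> B \<inter> V" using imUV by auto
      then obtain w where w: "w \<in> W" "\<phi> x = F (\<phi> w, \<phi> w)" using B(3) by blast
      then have wU: "w \<in> U" using W(3) by blast
      then have "\<phi> x = \<phi> (w \<otimes>\<^bsub>G\<^esub> w)" using w F by simp
      then have "x = w \<otimes>\<^bsub>G\<^esub> w" using inj x(1) WW[OF w(1) w(1)] by (auto dest: inj_onD)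
      then show "x \<in> (\<lambda>x. x \<otimes>\<^bsub>G\<^esub> x) ` carrier G" using wU UG by blast
    qed
  qed
qed

lemma connected_lie_group_generated_by_squares:
  assumes lie: "lie_group G T V A" and conn: "connected_space T"
  shows "generated_by_squares G"
proof -
  from lie have "group G" and top: "topspace T = carrier G"
    and cont: "continuous_map (prod_topology T T) T (\<lambda>(x, y). x \<otimes>\<^bsub>G\<^esub> y)"
    unfolding lie_group_def smooth_map_def by auto
  have translation: "continuous_map T T (\<lambda>x. x \<otimes>\<^bsub>G\<^esub> g)" if "g \<in> carrier G" for g
  proof -
    have "continuous_map T (prod_topology T T) (\<lambda>x. (x, g))"
      using that top by (intro continuous_map_pairedI) auto
    from continuous_map_compose[OF this cont] show ?thesis by (simp add: o_def)
  qed
  obtain N where "openin T N" "\<one>\<^bsub>G\<^esub> \<in> N" "N \<subseteq> (\<lambda>x. x \<otimes>\<^bsub>G\<^esub> x) ` carrier G"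
    using lie by (rule lie_group_neighbourhood_of_squares)
  with \<open>group G\<close> top conn translation show ?thesis
    by (rule generated_by_squares_if_neighbourhood_of_squares)
qed

section \<open>Connected Lie groups are natural\<close>

text \<open>
  A point is determined by the set of indices of the basic open sets that contain it, and there are as
  many sets of naturals as reals.
\<close>

lemma second_countable_Hausdorff_inj_real:
  assumes "second_countable T" "Hausdorff_space T"
  obtains \<iota> :: "'a \<Rightarrow> real" where "inj_on \<iota> (topspace T)"
proof -
  obtain \<B> where \<B>: "countable \<B>"
    "\<forall>U x. openin T U \<and> x \<in> U \<longrightarrow> (\<exists>B\<in>\<B>. x \<in> B \<and> B \<subseteq> U)"
    using assms(1) unfolding second_countable_def by (elim exE conjE)
  obtain e :: "nat set \<Rightarrow> real" where e: "inj e"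
    using nat_sets_eqpoll_reals by (auto simp: eqpoll_def bij_betw_def)
  define N where "N x = to_nat_on \<B> ` {B \<in> \<B>. x \<in> B}" for x
  have "inj_on N (topspace T)"
  proof (rule inj_onI, rule ccontr)
    fix x y assume xy: "x \<in> topspace T" "y \<in> topspace T" "N x = N y" "x \<noteq> y"
    then obtain U where U: "openin T U" "x \<in> U" "y \<notin> U"
      using assms(2) unfolding Hausdorff_space_def disjnt_iff by meson
    then obtain B where B: "B \<in> \<B>" "x \<in> B" "B \<subseteq> U" using \<B>(2) by blast
    then have "to_nat_on \<B> B \<in> N y" using xy(3) by (auto simp: N_def)
    then have "y \<in> B"
      using B(1) inj_on_to_nat_on[OF \<B>(1)] by (auto simp: N_def dest: inj_onD)
    with U B show False by blast
  qed
  then have "inj_on (e \<circ> N) (topspace T)" using e by (simp add: comp_inj_on inj_on_subset)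
  then show thesis by (rule that)
qed

theorem theorem9:
  fixes G :: "('a, 'r) monoid_scheme"
    and T :: "'a topology"
    and V :: "'e::euclidean_space set"
    and A :: "('a, 'e) chart set"
  assumes "lie_group G T V A"
    and "connected_space T"
  shows "natural_group G"
proof -
  from assms(1) have "group G" and top: "topspace T = carrier G"
    and "second_countable T" "Hausdorff_space T"
    unfolding lie_group_def smooth_manifold_def by auto
  obtain \<iota> :: "'a \<Rightarrow> real" where "inj_on \<iota> (topspace T)"
    using \<open>second_countable T\<close> \<open>Hausdorff_space T\<close>
    by (rule second_countable_Hausdorff_inj_real)
  then have "inj_on \<iota> (carrier G)" by (simp only: top)
  with \<open>group G\<close> connected_lie_group_generated_by_squares[OF assms] show ?thesis
    by (rule natural_group_if_generated_by_squares)
qed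

end
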